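(* Let $\Delta\subset\mathbb R^2$ be the triangular region with vertices $P_1,P_2,P_3$. A point $m\in\mathbb R^2$ is the geometric median of $\Delta$ if and only if $$\frac{\Sigma_{P_1P_2}(m)}{|P_2-P_1|}\,\overrightarrow{P_1P_2}+\frac{\Sigma_{P_2P_3}(m)}{|P_3-P_2|}\,\overrightarrow{P_2P_3}+\frac{\Sigma_{P_3P_1}(m)}{|P_1-P_3|}\,\overrightarrow{P_3P_1}=0.$$
   Context: $|\cdot|$ is the Euclidean norm on $\mathbb R^2$, so $|P-X|$ is the Euclidean distance between the points $P$ and $X$. A triangular region is the (two-dimensional) region bounded by a triangle with non-collinear vertices. For a region $\Omega\subset\mathbb R^2$ put $\Sigma_\Omega(X)=\int_{P\in\Omega}|P-X|\,dP$ (integral with respect to area), $X\in\mathbb R^2$. The geometric median of $\Omega$ is the point $m=\mathop{\mathrm{arg\,min}}_{X\in\mathbb R^2}\Sigma_\Omega(X)$. For points $A,B\in\mathbb R^2$, $\Sigma_{AB}(X)=\int_{P\in AB}|P-X|\,dP$ is the integral over the line segment $AB$ with respect to arc length, so $\Sigma_{AB}(X)/|B-A|$ is the average distance from $X$ to the points of the segment $AB$. $\overrightarrow{AB}=B-A$. *)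

theory Defs
  imports "HOL-Analysis.Analysis"
begin

definition region_dist :: "(real^2) set \<Rightarrow> real^2 \<Rightarrow> real" where
  "region_dist \<Omega> X = (LINT P:\<Omega>|lborel. norm (P - X))"

(* The definite description is meaningful only when the minimiser over the whole plane exists
   and is unique; where it is not, geometric_median is an unspecified point. *)
definition geometric_median :: "(real^2) set \<Rightarrow> real^2" where
  "geometric_median \<Omega> = (THE m. is_arg_min (region_dist \<Omega>) (\<lambda>X. True) m)"

(* Line integral of a scalar function with respect to arc length, ds = |g'(t)| dt. *)
definition arc_length_integral :: "(real \<Rightarrow> real^2) \<Rightarrow> (real^2 \<Rightarrow> real) \<Rightarrow> real" where
  "arc_length_integral g f =
     (LINT t:{0..1}|lborel. f (g t) * norm (vector_derivative g (at t within {0..1})))"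

definition segment_dist :: "real^2 \<Rightarrow> real^2 \<Rightarrow> real^2 \<Rightarrow> real" where
  "segment_dist A B X = arc_length_integral (linepath A B) (\<lambda>P. norm (P - X))"

end

theory Submission
  imports Defs
begin

text \<open>
  The function \<open>region_dist \<Omega>\<close> is convex, and integrating the supporting lines of the norm shows that
  \<open>- I X\<close> with \<open>I X v = \<integral>\<^sub>\<Omega> sgn (P - X) \<bullet> v\<close> is a subgradient at \<open>X\<close>. As \<open>I\<close> is continuous in \<open>X\<close>,
  the minimisers are exactly the zeros of \<open>I\<close>; coercivity and strict convexity give exactly one.
  For a triangle with edge vectors \<open>u\<close>, \<open>w\<close> at \<open>P1\<close>, Fubini along chords parallel to an edge evaluates \<open>I X u\<close>
  and \<open>I X w\<close> as multiples of differences of the average distances to two sides. So \<open>I X = 0\<close> says that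
  the three averages agree, which by independence of \<open>u\<close> and \<open>w\<close> is the vector equation, since the
  edge vectors sum to zero.
\<close>

subsection \<open>Minimisers of the total distance\<close>

lemma set_integrable_compact:
  fixes f :: "'a::euclidean_space \<Rightarrow> 'b::{banach, second_countable_topology}"
  assumes "compact S" "continuous_on S f"
  shows "set_integrable lborel S f"
  unfolding set_integrable_def by (rule borel_integrable_compact[OF assms])

lemma set_integrable_bounded_measurable:
  fixes h :: "'a::euclidean_space \<Rightarrow> real"
  assumes [measurable]: "h \<in> borel_measurable borel" and "\<And>P. \<bar>h P\<bar> \<le> B" and "compact S"
  shows "set_integrable lborel S h"
proof (rule set_integrable_bound)
  show "set_integrable lborel S (\<lambda>P. B)"
    by (intro set_integrable_compact continuous_intros assms)
  have [measurable]: "S \<in> sets borel"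
    using assms by (simp add: compact_imp_closed)
  show "set_borel_measurable lborel S h"
    unfolding set_borel_measurable_def by simp
  show "AE P in lborel. P \<in> S \<longrightarrow> norm (h P) \<le> norm B"
    using assms(2) by (auto intro!: AE_I2 intro: order_trans[OF _ abs_ge_self])
qed

lemma set_integrable_norm_diff:
  fixes X :: "'a::euclidean_space"
  assumes "compact S"
  shows "set_integrable lborel S (\<lambda>P. norm (P - X))"
  by (intro set_integrable_compact continuous_intros assms)

lemma borel_measurable_sgn_inner [measurable]:
  fixes X v :: "'a::euclidean_space"
  shows "(\<lambda>P. sgn (P - X) \<bullet> v) \<in> borel_measurable borel"
  unfolding sgn_div_norm by measurable

lemma abs_sgn_inner_le:
  fixes x v :: "'a::real_inner"
  shows "\<bar>sgn x \<bullet> v\<bar> \<le> norm v"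
  using Cauchy_Schwarz_ineq2[of "sgn x" v] by (cases "x = 0") (auto simp: norm_sgn)

lemma set_integrable_sgn_inner:
  fixes X v :: "'a::euclidean_space"
  assumes "compact S"
  shows "set_integrable lborel S (\<lambda>P. sgn (P - X) \<bullet> v)"
  by (rule set_integrable_bounded_measurable[OF borel_measurable_sgn_inner abs_sgn_inner_le assms])

text \<open>For \<open>x\<close> nonzero, \<open>norm x = sgn x \<bullet> x\<close>, so the left
  side is \<open>sgn x \<bullet> (x - v)\<close>, and Cauchy-Schwarz with the unit vector
  \<open>sgn x\<close> applies. At \<open>x = 0\<close> the convention \<open>sgn 0 = 0\<close>
  picks the subgradient zero.\<close>

lemma norm_supporting_line:
  fixes x v :: "'a::real_inner"
  shows "norm x - sgn x \<bullet> v \<le> norm (x - v)"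
proof (cases "x = 0")
  case False
  have "norm x - sgn x \<bullet> v = sgn x \<bullet> (x - v)"
    using False by (simp add: sgn_div_norm inner_diff_right field_simps dot_square_norm power2_eq_square)
  also have "\<dots> \<le> norm (x - v)"
    using norm_cauchy_schwarz[of "sgn x" "x - v"] False by (simp add: norm_sgn)
  finally show ?thesis .
qed auto

text \<open>Integrating the pointwise supporting lines gives the subgradient inequality directly,
  without differentiating under the integral sign.\<close>

lemma region_dist_supporting_plane:
  assumes "compact \<Omega>"
  shows "region_dist \<Omega> X - (LINT P:\<Omega>|lborel. sgn (P - X) \<bullet> v) \<le> region_dist \<Omega> (X + v)"
proof -
  have "(LINT P:\<Omega>|lborel. norm (P - X) - sgn (P - X) \<bullet> v) \<le> (LINT P:\<Omega>|lborel. norm (P - (X + v)))"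
  proof (rule set_integral_mono)
    show "norm (P - X) - sgn (P - X) \<bullet> v \<le> norm (P - (X + v))" for P
      using norm_supporting_line[of "P - X" v] by (simp add: algebra_simps)
  qed (intro set_integral_diff set_integrable_norm_diff set_integrable_sgn_inner assms)+
  then show ?thesis
    unfolding region_dist_def
    by (simp add: set_integral_diff set_integrable_norm_diff set_integrable_sgn_inner assms)
qed

text \<open>Dominated convergence with the constant bound \<open>norm v\<close>: the integrands
  converge except possibly at \<open>P = X\<close>, where \<open>sgn\<close> jumps, and a single
  point is null.\<close>

lemma sgn_integral_tendsto:
  fixes X v :: "'a::euclidean_space"
  assumes "compact S" "Y \<longlonglongrightarrow> X"
  shows "(\<lambda>n. LINT P:S|lborel. sgn (P - Y n) \<bullet> v) \<longlonglongrightarrow> (LINT P:S|lborel. sgn (P - X) \<bullet> v)"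
  unfolding set_lebesgue_integral_def
proof (rule integral_dominated_convergence)
  show "integrable lborel (\<lambda>P. indicator S P *\<^sub>R norm v)"
    using set_integrable_compact[OF assms(1), of "\<lambda>_. norm v"] by (simp add: set_integrable_def)
  have [measurable]: "S \<in> sets borel"
    using assms(1) by (simp add: compact_imp_closed)
  show "(\<lambda>P. indicator S P *\<^sub>R (sgn (P - X) \<bullet> v)) \<in> borel_measurable lborel"
    "\<And>n. (\<lambda>P. indicator S P *\<^sub>R (sgn (P - Y n) \<bullet> v)) \<in> borel_measurable lborel"
    by measurable
  show "AE P in lborel. norm (indicator S P *\<^sub>R (sgn (P - Y n) \<bullet> v)) \<le> indicator S P *\<^sub>R norm v" for n
    by (auto simp: abs_sgn_inner_le indicator_def)
  show "AE P in lborel. (\<lambda>n. indicator S P *\<^sub>R (sgn (P - Y n) \<bullet> v)) \<longlonglongrightarrow> indicator S P *\<^sub>R (sgn (P - X) \<bullet> v)"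
    using AE_lborel_singleton[of X]
  proof eventually_elim
    case (elim P)
    then show ?case
      by (intro tendsto_intros assms(2)) simp
  qed
qed

lemma region_dist_minimal_iff:
  assumes "compact \<Omega>"
  shows "(\<forall>Y. region_dist \<Omega> X \<le> region_dist \<Omega> Y) \<longleftrightarrow>
    (\<forall>v. (LINT P:\<Omega>|lborel. sgn (P - X) \<bullet> v) = 0)"
proof
  assume zero: "\<forall>v. (LINT P:\<Omega>|lborel. sgn (P - X) \<bullet> v) = 0"
  show "\<forall>Y. region_dist \<Omega> X \<le> region_dist \<Omega> Y"
  proof
    fix Y show "region_dist \<Omega> X \<le> region_dist \<Omega> Y"
      using region_dist_supporting_plane[OF assms, of X "Y - X"] zero by simp
  qed
next
  assume min: "\<forall>Y. region_dist \<Omega> X \<le> region_dist \<Omega> Y"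
  let ?I = "\<lambda>X v. LINT P:\<Omega>|lborel. sgn (P - X) \<bullet> v"
  have le: "?I X v \<le> 0" for v
  proof (rule LIMSEQ_le_const2)
    let ?h = "\<lambda>n. inverse (real (Suc n))"
    have "(\<lambda>n. X + ?h n *\<^sub>R v) \<longlonglongrightarrow> X + 0 *\<^sub>R v"
      by (intro tendsto_intros LIMSEQ_inverse_real_of_nat)
    then show "(\<lambda>n. ?I (X + ?h n *\<^sub>R v) v) \<longlonglongrightarrow> ?I X v"
      by (intro sgn_integral_tendsto assms) simp
    have "?I (X + h *\<^sub>R v) v \<le> 0" if "h > 0" for h
    proof -
      \<comment> \<open>The supporting plane is taken at the displaced point and evaluated back at
        \<open>X\<close>. Minimality of \<open>X\<close> then bounds the integral at
        \<open>X + h *\<^sub>R v\<close>, and continuity carries the bound to \<open>X\<close> as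
        \<open>h\<close> tends to 0.\<close>
      have "region_dist \<Omega> (X + h *\<^sub>R v) + h * ?I (X + h *\<^sub>R v) v \<le> region_dist \<Omega> X"
        using region_dist_supporting_plane[OF assms, of "X + h *\<^sub>R v" "- (h *\<^sub>R v)"]
        by (simp add: set_lebesgue_integral_def mult.left_commute[of _ h])
      then have "h * ?I (X + h *\<^sub>R v) v \<le> 0"
        using min[rule_format, of "X + h *\<^sub>R v"] by linarith
      then show ?thesis
        using that by (simp add: mult_le_0_iff)
    qed
    then show "\<exists>N. \<forall>n\<ge>N. ?I (X + ?h n *\<^sub>R v) v \<le> 0"
      by simp
  qed
  show "\<forall>v. ?I X v = 0"
  proof
    fix v
    \<comment> \<open>The one-sided bound holds in every direction, so oddness in \<open>v\<close>
      turns it into an equality.\<close>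
    have "?I X (- v) = - ?I X v"
      by (simp add: set_lebesgue_integral_def)
    with le[of v] le[of "- v"] show "?I X v = 0" by linarith
  qed
qed

section \<open>Existence and uniqueness of the minimiser\<close>

lemma measure_pos_if_not_negligible:
  fixes S :: "'a::euclidean_space set"
  assumes "compact S" "\<not> negligible S"
  shows "0 < measure lborel S"
proof -
  have "S \<notin> null_sets lborel"
    using assms(2) negligible_iff_null_sets null_sets_completionI by blast
  then have "emeasure lborel S \<noteq> 0"
    using assms(1) by (auto simp: null_sets_def compact_imp_closed)
  moreover have "emeasure lborel S < \<infinity>"
    using assms(1) by (intro emeasure_bounded_finite compact_imp_bounded)
  ultimately show ?thesis
    by (simp add: measure_def enn2real_positive_iff zero_less_iff_neq_zero)
qed

text \<open>Integrates the triangle inequality over \<open>\<Omega>\<close>. The resulting linear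
  growth confines the search for a minimiser to a ball.\<close>

lemma region_dist_coercive:
  assumes "compact \<Omega>"
  shows "measure lborel \<Omega> * norm (X - Y) - region_dist \<Omega> Y \<le> region_dist \<Omega> X"
proof -
  have int: "set_integrable lborel \<Omega> (\<lambda>P. norm (X - Y))"
    by (intro set_integrable_compact continuous_intros assms)
  have "emeasure lborel \<Omega> \<noteq> \<infinity>"
    using emeasure_bounded_finite[OF compact_imp_bounded[OF assms]] by auto
  then have "measure lborel \<Omega> * norm (X - Y) - region_dist \<Omega> Y
      = (LINT P:\<Omega>|lborel. norm (X - Y) - norm (P - Y))"
    using assms int
    by (simp add: region_dist_def set_integral_diff set_integrable_norm_diff compact_imp_closed set_integral_const)
  also have "\<dots> \<le> region_dist \<Omega> X"
    unfolding region_dist_def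
  proof (rule set_integral_mono)
    show "norm (X - Y) - norm (P - Y) \<le> norm (P - X)" for P
      by norm
  qed (intro set_integral_diff set_integrable_norm_diff int assms)+
  finally show ?thesis .
qed

lemma continuous_on_region_dist:
  assumes "compact \<Omega>"
  shows "continuous_on A (region_dist \<Omega>)"
proof -
  have *: "region_dist \<Omega> X \<le> region_dist \<Omega> Y + measure lborel \<Omega> * norm (X - Y)" for X Y
  proof -
    have int: "set_integrable lborel \<Omega> (\<lambda>P. norm (X - Y))"
      by (intro set_integrable_compact continuous_intros assms)
    have "region_dist \<Omega> X \<le> (LINT P:\<Omega>|lborel. norm (P - Y) + norm (X - Y))"
      unfolding region_dist_def
    proof (rule set_integral_mono)
      show "norm (P - X) \<le> norm (P - Y) + norm (X - Y)" for P
        by norm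
    qed (intro set_integral_add set_integrable_norm_diff int assms)+
    also have "\<dots> = region_dist \<Omega> Y + measure lborel \<Omega> * norm (X - Y)"
      using emeasure_bounded_finite[OF compact_imp_bounded[OF assms]] assms int
      by (simp add: region_dist_def set_integral_add set_integrable_norm_diff compact_imp_closed
        set_integral_const)
    finally show ?thesis .
  qed
  have "dist (region_dist \<Omega> X) (region_dist \<Omega> Y) \<le> measure lborel \<Omega> * dist X Y" for X Y
    using *[of X Y] *[of Y X] by (simp add: dist_real_def dist_norm norm_minus_commute[of Y X] abs_le_iff)
  then have "lipschitz_on (measure lborel \<Omega>) A (region_dist \<Omega>)"
    by (intro lipschitz_onI) auto
  then show ?thesis
    by (rule lipschitz_on_continuous_on)
qed

lemma region_dist_minimiser_exists:
  assumes "compact \<Omega>" "\<not> negligible \<Omega>"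
  shows "\<exists>X. \<forall>Y. region_dist \<Omega> X \<le> region_dist \<Omega> Y"
proof -
  let ?\<mu> = "measure lborel \<Omega>"
  have pos: "0 < ?\<mu>"
    by (rule measure_pos_if_not_negligible[OF assms])
  \<comment> \<open>With this radius, coercivity about the origin shows that every point outside the
    ball does no better than 0, which lies in the ball.\<close>
  define r where "r = 2 * region_dist \<Omega> 0 / ?\<mu>"
  have "0 \<le> region_dist \<Omega> 0"
    unfolding region_dist_def set_lebesgue_integral_def by (intro Bochner_Integration.integral_nonneg) auto
  then have "0 \<in> cball (0::real^2) r"
    using pos by (simp add: r_def)
  then obtain X where X: "\<forall>Y\<in>cball 0 r. region_dist \<Omega> X \<le> region_dist \<Omega> Y"
    using continuous_attains_inf[OF compact_cball _ continuous_on_region_dist[OF assms(1)], of 0 r]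
    by blast
  have "region_dist \<Omega> X \<le> region_dist \<Omega> Y" for Y
  proof (cases "Y \<in> cball 0 r")
    case False
    then have "2 * region_dist \<Omega> 0 \<le> ?\<mu> * norm Y"
      using pos by (simp add: r_def field_simps)
    then have "region_dist \<Omega> 0 \<le> region_dist \<Omega> Y"
      using region_dist_coercive[OF assms(1), of Y 0] by simp
    then show ?thesis
      using X \<open>0 \<in> cball 0 r\<close> order_trans by blast
  qed (use X in blast)
  then show ?thesis by blast
qed

text \<open>Equality in the triangle inequality for \<open>P - X\<close> and \<open>P - Y\<close> confines \<open>P\<close> to the line \<open>XY\<close>,
  which is null: so the objective is strictly convex.\<close>

lemma region_dist_minimiser_unique:
  assumes "compact \<Omega>" "\<not> negligible \<Omega>"
    and X: "\<And>Z. region_dist \<Omega> X \<le> region_dist \<Omega> Z"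
    and Y: "\<And>Z. region_dist \<Omega> Y \<le> region_dist \<Omega> Z"
  shows "X = Y"
proof (rule ccontr)
  assume "X \<noteq> Y"
  let ?M = "(1/2) *\<^sub>R (X + Y)"
  \<comment> \<open>Twice the convexity defect at the midpoint. It is nonnegative pointwise, while
    minimality at \<open>X\<close> and \<open>Y\<close> makes its integral at most 0, so it vanishes
    almost everywhere on \<open>\<Omega>\<close>.\<close>
  let ?gap = "\<lambda>P. norm (P - X) + norm (P - Y) - 2 * norm (P - ?M)"
  have tri: "2 * norm (P - ?M) = norm ((P - X) + (P - Y))" for P
  proof -
    have "(P - X) + (P - Y) = 2 *\<^sub>R (P - ?M)"
      by (simp add: algebra_simps scaleR_2)
    then show ?thesis by simp
  qed
  note ints = set_integrable_norm_diff[OF assms(1)] set_integral_add set_integral_diff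
  have int: "set_integrable lborel \<Omega> ?gap"
    by (intro ints set_integrable_mult_right)
  have "(LINT P:\<Omega>|lborel. ?gap P) = region_dist \<Omega> X + region_dist \<Omega> Y - 2 * region_dist \<Omega> ?M"
    by (simp add: region_dist_def ints set_integrable_mult_right)
  also have "\<dots> \<le> 0"
    using X[of ?M] Y[of ?M] by simp
  finally have "(LINT P:\<Omega>|lborel. ?gap P) \<le> 0" .
  moreover have nonneg: "0 \<le> ?gap P" for P
    unfolding tri using norm_triangle_ineq[of "P - X" "P - Y"] by simp
  ultimately have "(LINT P|lborel. indicator \<Omega> P *\<^sub>R ?gap P) = 0"
    unfolding set_lebesgue_integral_def
    by (intro antisym Bochner_Integration.integral_nonneg) (auto simp: indicator_def)
  then have AE: "AE P in lborel. indicator \<Omega> P *\<^sub>R ?gap P = 0"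
    using integral_nonneg_eq_0_iff_AE[OF int[unfolded set_integrable_def]] nonneg
    by (simp add: indicator_def)
  \<comment> \<open>\<open>Y - X\<close> turned by a right angle: a normal of the line through
    \<open>X\<close> and \<open>Y\<close>.\<close>
  define a :: "real^2" where "a = vector [Y$2 - X$2, X$1 - Y$1]"
  have "a \<noteq> 0"
    using \<open>X \<noteq> Y\<close> by (auto simp: a_def vec_eq_iff forall_2)
  have "\<Omega> \<subseteq> {P. a \<bullet> P = a \<bullet> X} \<union> {P. indicator \<Omega> P *\<^sub>R ?gap P \<noteq> 0}"
  proof
    fix P assume "P \<in> \<Omega>"
    show "P \<in> {P. a \<bullet> P = a \<bullet> X} \<union> {P. indicator \<Omega> P *\<^sub>R ?gap P \<noteq> 0}"
    proof (cases "?gap P = 0")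
      case True
      then have eq: "norm (P - X) *\<^sub>R (P - Y) = norm (P - Y) *\<^sub>R (P - X)"
        unfolding tri using norm_triangle_eq[of "P - X" "P - Y"] by simp
      have "a \<bullet> (P - X) = 0"
      proof (cases "P = X")
        case False
        \<comment> \<open>The right side is a 2x2 determinant of \<open>P - X\<close> and a multiple
          of \<open>P - Y\<close>; by \<open>eq\<close> the latter is a multiple of
          \<open>P - X\<close>, so it vanishes.\<close>
        have "norm (P - X) * (a \<bullet> (P - X)) = 
          (P$2 - X$2) * (norm (P - X) *\<^sub>R (P - Y))$1 - (P$1 - X$1) * (norm (P - X) *\<^sub>R (P - Y))$2"
          by (simp add: a_def inner_vec_def sum_2 algebra_simps)
        also have "\<dots> = 0"
          unfolding eq by simp
        finally show ?thesis using False by simp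
      qed auto
      then show ?thesis by (simp add: inner_diff_right)
    qed (use \<open>P \<in> \<Omega>\<close> in simp)
  qed
  moreover have "negligible {P. indicator \<Omega> P *\<^sub>R ?gap P \<noteq> 0}"
  proof -
    obtain N where N: "{P. indicator \<Omega> P *\<^sub>R ?gap P \<noteq> 0} \<subseteq> N" "N \<in> null_sets lborel"
      using AE unfolding eventually_ae_filter by auto
    then have "negligible N"
      using N(2) by (simp add: negligible_iff_null_sets null_sets_completionI)
    with N(1) show ?thesis by (rule negligible_subset[rotated])
  qed
  ultimately show False
    using assms(2) \<open>a \<noteq> 0\<close> negligible_subset[OF negligible_Un[OF negligible_hyperplane]] by blast
qed

lemma geometric_median_iff_minimal:
  assumes "compact \<Omega>" "\<not> negligible \<Omega>"
  shows "m = geometric_median \<Omega> \<longleftrightarrow> (\<forall>X. region_dist \<Omega> m \<le> region_dist \<Omega> X)"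
proof -
  have "\<exists>!m. \<forall>X. region_dist \<Omega> m \<le> region_dist \<Omega> X"
    using region_dist_minimiser_exists[OF assms] region_dist_minimiser_unique[OF assms] by blast
  moreover have "geometric_median \<Omega> = (THE m. \<forall>X. region_dist \<Omega> m \<le> region_dist \<Omega> X)"
    by (simp add: geometric_median_def is_arg_min_linorder)
  ultimately show ?thesis
    using theI_unique[of "\<lambda>m. \<forall>X. region_dist \<Omega> m \<le> region_dist \<Omega> X" m] by metis
qed

subsection \<open>Integration over triangles\<close>

lemma borel_measurable_pair_vec2:
  "(\<lambda>(x, y). vector [x, y] :: real^2) \<in> borel_measurable borel"
proof -
  have "linear (\<lambda>(x, y). vector [x, y] :: real^2)"
    by (rule linearI) (auto simp: vec_eq_iff forall_2)
  then show ?thesis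
    by (intro borel_measurable_continuous_onI linear_continuous_on linear_linear[THEN iffD2])
qed

text \<open>Transfers Lebesgue measure from \<open>real \<times> real\<close>, where Fubini is
  stated, to \<open>real^2\<close>. The coordinate map matches boxes with boxes of equal volume, and
  these values determine \<open>lborel\<close>.\<close>

lemma distr_lborel_pair_vec2:
  "distr (lborel :: (real \<times> real) measure) borel (\<lambda>(x, y). vector [x, y] :: real^2) = lborel"
proof (rule sym, rule lborel_eqI)
  have meas: "(\<lambda>(x, y). vector [x, y] :: real^2) \<in> lborel \<rightarrow>\<^sub>M borel"
    using borel_measurable_pair_vec2 by simp
  fix l u :: "real^2"
  assume le: "\<And>b. b \<in> Basis \<Longrightarrow> l \<bullet> b \<le> u \<bullet> b"
  have le': "l $ i \<le> u $ i" for i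
    using le[of "axis i 1"] by (simp add: inner_axis)
  have pre: "(\<lambda>(x, y). vector [x, y] :: real^2) -` box l u = box (l$1, l$2) (u$1, u$2)"
    by (auto simp: mem_box_cart forall_2 mem_box Basis_prod_def)
  have "emeasure (distr (lborel :: (real \<times> real) measure) borel (\<lambda>(x, y). vector [x, y])) (box l u)
      = (\<Prod>b\<in>Basis. ((u$1, u$2) - (l$1, l$2)) \<bullet> b)"
    using le' by (simp add: emeasure_distr[OF meas] pre emeasure_lborel_box_eq Basis_prod_def mult.commute)
  also have "\<dots> = (u$1 - l$1) * (u$2 - l$2)"
    by (simp add: Basis_prod_def mult.commute)
  also have "\<dots> = (\<Prod>b\<in>Basis. (u - l) \<bullet> b)"
    by (simp add: Basis_vec_def UNION_singleton_eq_range prod.reindex inj_on_def axis_eq_axis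
        inner_axis UNIV_2 mult.commute)
  finally show "emeasure (distr (lborel :: (real \<times> real) measure) borel (\<lambda>(x, y). vector [x, y])) (box l u)
      = (\<Prod>b\<in>Basis. (u - l) \<bullet> b)" .
qed simp


lemma set_integral_vec2_Fubini:
  fixes k :: "real^2 \<Rightarrow> real"
  assumes "set_integrable lborel S k"
    and S: "S = {z. 0 \<le> z$1 \<and> 0 \<le> z$2 \<and> z$1 + z$2 \<le> 1}"
  shows "(LINT z:S|lborel. k z) = (LINT t:{0..1}|lborel. LINT s:{0..1-t}|lborel. k (vector [s, t]))"
proof -
  let ?K = "\<lambda>z. indicator S z *\<^sub>R k z"
  let ?V = "\<lambda>(x, y). vector [x, y] :: real^2"
  have int: "integrable lborel ?K"
    using assms(1) by (simp add: set_integrable_def)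
  note V = borel_measurable_pair_vec2
  have int2: "integrable (lborel \<Otimes>\<^sub>M lborel) (\<lambda>(x, y). ?K (vector [x, y]))"
    using int V unfolding lborel_prod
    by (subst (asm) distr_lborel_pair_vec2[symmetric], subst (asm) integrable_distr_eq)
       (auto simp: case_prod_unfold borel_measurable_integrable)
  have "(LINT z:S|lborel. k z) = (\<integral>z. ?K z \<partial>distr (lborel :: (real \<times> real) measure) borel ?V)"
    unfolding set_lebesgue_integral_def distr_lborel_pair_vec2 ..
  also have "\<dots> = (\<integral>p. ?K (?V p) \<partial>(lborel :: (real \<times> real) measure))"
    using V borel_measurable_integrable[OF int] by (intro integral_distr) auto
  also have "\<dots> = (\<integral>(x, y). ?K (vector [x, y]) \<partial>(lborel \<Otimes>\<^sub>M lborel))"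
    unfolding lborel_prod by (simp add: case_prod_unfold)
  also have "\<dots> = (\<integral>t. \<integral>s. ?K (vector [s, t]) \<partial>lborel \<partial>lborel)"
    by (rule lborel_pair.integral_snd[OF int2, symmetric])
  also have "\<dots> = (LINT t:{0..1}|lborel. LINT s:{0..1-t}|lborel. k (vector [s, t]))"
    unfolding set_lebesgue_integral_def
  proof (intro Bochner_Integration.integral_cong refl)
    fix t :: real
    \<comment> \<open>For \<open>t\<close> in \<open>{0..1}\<close> the horizontal slice of
      \<open>S\<close> is \<open>{0..1-t}\<close>; for all other \<open>t\<close> it is
      empty.\<close>
    have "?K (vector [s, t]) = indicator {0..1} t *\<^sub>R (indicator {0..1-t} s *\<^sub>R k (vector [s, t]))" for s
      by (auto simp: S indicator_def)
    then show "(\<integral>s. ?K (vector [s, t]) \<partial>lborel) =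
        indicator {0..1} t *\<^sub>R (\<integral>s. indicator {0..1-t} s *\<^sub>R k (vector [s, t]) \<partial>lborel)"
      by (simp only: integral_scaleR_right)
  qed
  finally show ?thesis .
qed

lemma set_integral_affine_image_vec2:
  fixes a u w :: "real^2" and h :: "real^2 \<Rightarrow> real"
  defines "g \<equiv> \<lambda>z :: real^2. a + z$1 *\<^sub>R u + z$2 *\<^sub>R w"
  assumes h[measurable]: "h \<in> borel_measurable borel" and B: "\<And>P. \<bar>h P\<bar> \<le> B"
    and d: "u$1 * w$2 - u$2 * w$1 \<noteq> 0" and "compact S"
  shows "(LINT P:g ` S|lborel. h P) = \<bar>u$1 * w$2 - u$2 * w$1\<bar> * (LINT z:S|lborel. h (g z))"
proof -
  let ?d = "u$1 * w$2 - u$2 * w$1"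
  let ?g' = "\<lambda>z::real^2. z$1 *\<^sub>R u + z$2 *\<^sub>R w"
  have "continuous_on A g" for A
    unfolding g_def by (intro continuous_intros)
  then have [measurable]: "g \<in> borel_measurable borel" and "compact (g ` S)"
    by (auto intro: borel_measurable_continuous_onI compact_continuous_image \<open>compact S\<close>)
  have der: "(g has_derivative ?g') (at z within A)" for z A
    unfolding g_def by (auto intro!: derivative_eq_intros bounded_linear_imp_has_derivative)
  have inj: "inj_on g A" for A
  proof (rule inj_onI)
    fix y z assume "g y = g z"
    then have "y$1 * u$1 + y$2 * w$1 = z$1 * u$1 + z$2 * w$1"
      "y$1 * u$2 + y$2 * w$2 = z$1 * u$2 + z$2 * w$2"
      by (auto simp: g_def vec_eq_iff forall_2)
    \<comment> \<open>Cramer's rule: eliminating one unknown leaves the other times the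
      determinant.\<close>
    then have "(y$1 - z$1) * ?d = 0" "(y$2 - z$2) * ?d = 0"
      by algebra+
    then show "y = z"
      using d by (simp add: vec_eq_iff forall_2)
  qed
  have det: "det (matrix ?g') = ?d"
    by (simp add: det_2 matrix_def axis_def)
  have S: "S \<in> sets lebesgue"
    using \<open>compact S\<close> by (simp add: lmeasurable_compact fmeasurableD)
  have intS: "set_integrable lborel S (\<lambda>z. h (g z))"
    by (rule set_integrable_bounded_measurable[OF _ B \<open>compact S\<close>]) simp
  have intgS: "set_integrable lborel (g ` S) h"
    by (rule set_integrable_bounded_measurable[OF h B \<open>compact (g ` S)\<close>])
  \<comment> \<open>The change of variables theorem concerns integrands with values in some
    \<open>real^'n\<close>, so the scalar \<open>h\<close> is lifted to \<open>real^1\<close> and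
    later recovered as component 1.\<close>
  let ?H = "\<lambda>P. vec (h P) :: real^1"
  have absS: "(\<lambda>z. \<bar>?d\<bar> *\<^sub>R ?H (g z)) absolutely_integrable_on S"
  proof (subst absolutely_integrable_componentwise_iff, safe)
    fix b :: "real^1" assume "b \<in> Basis"
    then have b: "\<And>c. vec c \<bullet> b = c"
      by (auto simp: Basis_vec_def inner_axis)
    have "(\<lambda>z. h (g z)) absolutely_integrable_on S"
      using intS borel_measurable_integrable[OF intS[unfolded set_integrable_def]]
      by (simp add: set_integrable_def integrable_completion)
    then show "(\<lambda>z. (\<bar>?d\<bar> *\<^sub>R ?H (g z)) \<bullet> b) absolutely_integrable_on S"
      by (simp add: b)
  qed
  have "?H absolutely_integrable_on g ` S \<and>
     integral (g ` S) ?H = integral S (\<lambda>z. \<bar>?d\<bar> *\<^sub>R ?H (g z))"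
    using has_absolute_integral_change_of_variables[OF S der inj, of ?H] absS unfolding det by blast
  then have eq: "integral (g ` S) ?H $ 1 = integral S (\<lambda>z. \<bar>?d\<bar> *\<^sub>R ?H (g z)) $ 1"
    and int: "?H integrable_on g ` S"
    by (auto simp: set_lebesgue_integral_eq_integral)
  have "(\<lambda>z. \<bar>?d\<bar> *\<^sub>R ?H (g z)) integrable_on S"
    using absS by (rule set_lebesgue_integral_eq_integral)
  from integral_component_eq_cart[OF int, of 1] integral_component_eq_cart[OF this, of 1] eq
  have "integral (g ` S) h = integral S (\<lambda>z. \<bar>?d\<bar> * h (g z))"
    by (simp del: integral_component_eq_cart integral_mult_right integral_cmul)
  then show ?thesis
    by (simp add: set_borel_integral_eq_integral(2)[OF intS] set_borel_integral_eq_integral(2)[OF intgS])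
qed

text \<open>The simplex coordinates are the barycentric weights of \<open>a + u\<close> and
  \<open>a + w\<close>; the weight of \<open>a\<close> is what remains to 1.\<close>

lemma convex_hull_3_image_simplex:
  fixes a u w :: "real^2"
  shows "(\<lambda>z::real^2. a + z$1 *\<^sub>R u + z$2 *\<^sub>R w) ` {z. 0 \<le> z$1 \<and> 0 \<le> z$2 \<and> z$1 + z$2 \<le> 1}
    = convex hull {a, a + u, a + w}"
proof (intro equalityI subsetI)
  fix P assume "P \<in> convex hull {a, a + u, a + w}"
  then obtain r s t where "0 \<le> r" "0 \<le> s" "0 \<le> t" and rst: "r + s + t = 1"
    and P: "P = r *\<^sub>R a + s *\<^sub>R (a + u) + t *\<^sub>R (a + w)"
    unfolding convex_hull_3 by blast
  have "P = (r + s + t) *\<^sub>R a + s *\<^sub>R u + t *\<^sub>R w"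
    unfolding P by (simp add: algebra_simps)
  then have "P = (\<lambda>z::real^2. a + z$1 *\<^sub>R u + z$2 *\<^sub>R w) (vector [s, t])"
    by (simp add: rst)
  then show "P \<in> (\<lambda>z::real^2. a + z$1 *\<^sub>R u + z$2 *\<^sub>R w) ` {z. 0 \<le> z$1 \<and> 0 \<le> z$2 \<and> z$1 + z$2 \<le> 1}"
    by (rule image_eqI) (use \<open>0 \<le> r\<close> \<open>0 \<le> s\<close> \<open>0 \<le> t\<close> rst in auto)
next
  fix P assume "P \<in> (\<lambda>z::real^2. a + z$1 *\<^sub>R u + z$2 *\<^sub>R w) ` {z. 0 \<le> z$1 \<and> 0 \<le> z$2 \<and> z$1 + z$2 \<le> 1}"
  then obtain z :: "real^2" where z: "0 \<le> z$1" "0 \<le> z$2" "z$1 + z$2 \<le> 1"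
    and P: "P = a + z$1 *\<^sub>R u + z$2 *\<^sub>R w" by blast
  have "P = (1 - z$1 - z$2) *\<^sub>R a + z$1 *\<^sub>R (a + u) + z$2 *\<^sub>R (a + w)"
    unfolding P by (simp add: algebra_simps)
  moreover have "(1 - z$1 - z$2) + z$1 + z$2 = 1" "0 \<le> 1 - z$1 - z$2"
    using z by auto
  ultimately show "P \<in> convex hull {a, a + u, a + w}"
    unfolding convex_hull_3 using z(1,2) by blast
qed

text \<open>For \<open>a = 0\<close> and the two unit vectors the parametrisation is the identity,
  so the simplex is itself the convex hull of three points.\<close>

lemma compact_simplex_vec2: "compact {z::real^2. 0 \<le> z$1 \<and> 0 \<le> z$2 \<and> z$1 + z$2 \<le> 1}"
proof -
  have "(\<lambda>z::real^2. 0 + z$1 *\<^sub>R axis 1 1 + z$2 *\<^sub>R axis 2 1) = (\<lambda>z. z)"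
    by (auto simp: vec_eq_iff forall_2 axis_def)
  note convex_hull_3_image_simplex[of 0 "axis 1 1" "axis 2 1", unfolded this image_ident]
  then show ?thesis
    by (simp add: compact_convex_hull finite_imp_compact)
qed

lemma set_integral_triangle:
  fixes a u w :: "real^2" and h :: "real^2 \<Rightarrow> real"
  assumes h: "h \<in> borel_measurable borel" and B: "\<And>P. \<bar>h P\<bar> \<le> B"
    and d: "u$1 * w$2 - u$2 * w$1 \<noteq> 0"
  shows "(LINT P:convex hull {a, a + u, a + w}|lborel. h P) =
    \<bar>u$1 * w$2 - u$2 * w$1\<bar> *
      (LINT t:{0..1}|lborel. LINT s:{0..1-t}|lborel. h (a + s *\<^sub>R u + t *\<^sub>R w))"
proof -
  have "(\<lambda>z::real^2. a + z$1 *\<^sub>R u + z$2 *\<^sub>R w) \<in> borel_measurable borel"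
    by (intro borel_measurable_continuous_onI continuous_intros)
  from measurable_compose[OF this h]
  have "set_integrable lborel {z::real^2. 0 \<le> z$1 \<and> 0 \<le> z$2 \<and> z$1 + z$2 \<le> 1}
      (\<lambda>z. h (a + z$1 *\<^sub>R u + z$2 *\<^sub>R w))"
    by (rule set_integrable_bounded_measurable) (rule B compact_simplex_vec2)+
  from set_integral_vec2_Fubini[OF this refl] set_integral_affine_image_vec2[OF h B d compact_simplex_vec2]
  show ?thesis
    by (simp add: convex_hull_3_image_simplex)
qed

subsection \<open>Boundary form of the subgradient\<close>

text \<open>The fundamental theorem of calculus for the norm along a ray. Differentiability fails
  only where the ray meets 0, which happens for at most one \<open>s\<close> because
  \<open>u \<noteq> 0\<close>; a finite exceptional set is harmless.\<close>

lemma has_integral_sgn_ray: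
  fixes q u :: "'a::real_inner"
  assumes "u \<noteq> 0" "0 \<le> c"
  shows "((\<lambda>s. sgn (q + s *\<^sub>R u) \<bullet> u) has_integral (norm (q + c *\<^sub>R u) - norm q)) {0..c}"
proof -
  let ?Z = "{s. q + s *\<^sub>R u = 0}"
  have "s = t" if "s \<in> ?Z" "t \<in> ?Z" for s t
  proof -
    from that have "q + s *\<^sub>R u = q + t *\<^sub>R u" by simp
    then show ?thesis using assms(1) by simp
  qed
  then have "finite ?Z"
    by (metis (no_types, lifting) finite.simps insertI1 insert_absorb subsetI subset_antisym finite_subset
        singletonI)
  moreover have "((\<lambda>s. norm (q + s *\<^sub>R u)) has_vector_derivative sgn (q + s *\<^sub>R u) \<bullet> u) (at s)"
    if "s \<in> {0<..<c} - ?Z" for s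
  proof -
    have "((\<lambda>s. q + s *\<^sub>R u) has_derivative (\<lambda>h. h *\<^sub>R u)) (at s)"
      by (auto intro!: derivative_eq_intros)
    from has_derivative_compose[OF this has_derivative_norm] that
    have "((\<lambda>s. norm (q + s *\<^sub>R u)) has_derivative (\<lambda>h. (h *\<^sub>R u) \<bullet> sgn (q + s *\<^sub>R u))) (at s)"
      by simp
    then show ?thesis
      by (simp add: has_vector_derivative_def inner_commute)
  qed
  ultimately have "((\<lambda>s. sgn (q + s *\<^sub>R u) \<bullet> u) has_integral
      (norm (q + c *\<^sub>R u) - norm (q + 0 *\<^sub>R u))) {0..c}"
    by (intro fundamental_theorem_of_calculus_interior_strong[where S = ?Z] continuous_intros assms(2))
  then show ?thesis by simp
qed

lemma set_integral_sgn_ray: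
  fixes q u :: "'a::euclidean_space"
  assumes "u \<noteq> 0" "0 \<le> c"
  shows "(LINT s:{0..c}|lborel. sgn (q + s *\<^sub>R u) \<bullet> u) = norm (q + c *\<^sub>R u) - norm q"
proof -
  have "(\<lambda>s. sgn (q + s *\<^sub>R u) \<bullet> u) \<in> borel_measurable borel"
    unfolding sgn_div_norm by measurable
  then have "set_integrable lborel {0..c} (\<lambda>s. sgn (q + s *\<^sub>R u) \<bullet> u)"
    by (rule set_integrable_bounded_measurable[OF _ abs_sgn_inner_le compact_Icc])
  then show ?thesis
    using has_integral_sgn_ray[OF assms, of q]
    by (simp add: set_borel_integral_eq_integral integral_unique)
qed

lemma set_integrable_norm_linepath:
  "set_integrable lborel {0..1} (\<lambda>t. norm (linepath A B t - X))"
  by (intro set_integrable_compact continuous_intros compact_Icc continuous_on_linepath)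

text \<open>\<open>linepath A B\<close> has constant speed \<open>norm (B - A)\<close>. For distinct
  end points, dividing by the length therefore leaves the plain average over the parameter.\<close>

lemma segment_dist_eq_average:
  "segment_dist A B X = norm (B - A) * (LINT t:{0..1}|lborel. norm (linepath A B t - X))"
proof -
  have "segment_dist A B X = (LINT t:{0..1}|lborel. norm (B - A) * norm (linepath A B t - X))"
    unfolding segment_dist_def arc_length_integral_def
    by (rule set_lebesgue_integral_cong) (simp_all add: vector_derivative_linepath_within)
  then show ?thesis by simp
qed

text \<open>Substitutes \<open>1 - t\<close> for \<open>t\<close>. This reconciles the directions in
  which chord ends traverse the sides with the cyclic orientation of the theorem.\<close>

lemma segment_dist_commute: "segment_dist A B X = segment_dist B A X"
proof -
  let ?f = "\<lambda>A B t. indicator {0..1} t *\<^sub>R norm (linepath A B t - X)"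
  have "(\<integral>t. ?f A B t \<partial>lborel) = (\<integral>t. ?f A B (1 + (-1) * t) \<partial>lborel)"
    by (subst lborel_integral_real_affine[where c = "-1" and t = 1]) auto
  also have "\<dots> = (\<integral>t. ?f B A t \<partial>lborel)"
    by (rule Bochner_Integration.integral_cong) (auto simp: linepath_def indicator_def add.commute)
  finally show ?thesis
    by (simp add: segment_dist_eq_average set_lebesgue_integral_def norm_minus_commute)
qed

text \<open>Fubini along chords parallel to the side \<open>u\<close>: since \<open>sgn (P - X) \<bullet> u\<close> is the derivative of
  \<open>norm (P - X)\<close> in direction \<open>u\<close>, each chord contributes the difference of the distances of its end points,
  which lie on the two other sides.\<close>

lemma sgn_integral_triangle:
  fixes a u w X :: "real^2"
  assumes d: "u$1 * w$2 - u$2 * w$1 \<noteq> 0"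
  shows "(LINT P:convex hull {a, a + u, a + w}|lborel. sgn (P - X) \<bullet> u) =
    \<bar>u$1 * w$2 - u$2 * w$1\<bar> *
      (segment_dist (a + u) (a + w) X / norm (w - u) - segment_dist a (a + w) X / norm w)"
proof -
  have "u \<noteq> 0" "w \<noteq> 0" "u \<noteq> w"
    using d by auto
  have inner: "(LINT s:{0..1-t}|lborel. sgn (a + s *\<^sub>R u + t *\<^sub>R w - X) \<bullet> u)
      = norm (linepath (a + u) (a + w) t - X) - norm (linepath a (a + w) t - X)"
    if "t \<in> {0..1}" for t
  proof -
    \<comment> \<open>The chord at height \<open>t\<close> starts at \<open>q\<close> on the side
      from \<open>a\<close> to \<open>a + w\<close> and ends at
      \<open>q + (1 - t) *\<^sub>R u\<close> on the side opposite \<open>a\<close>, positions being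
      relative to \<open>X\<close>.\<close>
    define q where "q = a + t *\<^sub>R w - X"
    have chord: "a + s *\<^sub>R u + t *\<^sub>R w - X = q + s *\<^sub>R u" for s
      by (simp add: q_def)
    have ends: "linepath (a + u) (a + w) t - X = q + (1 - t) *\<^sub>R u" "linepath a (a + w) t - X = q"
      by (simp_all add: q_def linepath_def algebra_simps)
    show ?thesis
      unfolding chord ends using that by (intro set_integral_sgn_ray \<open>u \<noteq> 0\<close>) simp
  qed
  have "(LINT P:convex hull {a, a + u, a + w}|lborel. sgn (P - X) \<bullet> u) = \<bar>u$1 * w$2 - u$2 * w$1\<bar> *
      (LINT t:{0..1}|lborel. LINT s:{0..1-t}|lborel. sgn (a + s *\<^sub>R u + t *\<^sub>R w - X) \<bullet> u)"
    by (rule set_integral_triangle[OF borel_measurable_sgn_inner abs_sgn_inner_le d])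
  also have "(LINT t:{0..1}|lborel. LINT s:{0..1-t}|lborel. sgn (a + s *\<^sub>R u + t *\<^sub>R w - X) \<bullet> u)
    = (LINT t:{0..1}|lborel. norm (linepath (a + u) (a + w) t - X) - norm (linepath a (a + w) t - X))"
    by (rule set_lebesgue_integral_cong) (simp_all add: inner)
  also have "\<dots> = segment_dist (a + u) (a + w) X / norm (w - u) - segment_dist a (a + w) X / norm w"
    using \<open>w \<noteq> 0\<close> \<open>u \<noteq> w\<close>
    by (simp add: segment_dist_eq_average set_integral_diff set_integrable_norm_linepath)
  finally show ?thesis .
qed

section \<open>Nondegenerate triangles and the vector equation\<close>

lemma not_collinear_imp_det_nonzero:
  fixes P1 P2 P3 :: "real^2"
  assumes "\<not> collinear {P1, P2, P3}"
  shows "(P2 - P1)$1 * (P3 - P1)$2 - (P2 - P1)$2 * (P3 - P1)$1 \<noteq> 0"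
proof
  define u w where uw: "u = P2 - P1" "w = P3 - P1"
  assume "(P2 - P1)$1 * (P3 - P1)$2 - (P2 - P1)$2 * (P3 - P1)$1 = 0"
  then have d: "u$1 * w$2 = u$2 * w$1"
    by (simp add: uw)
  have nc: "\<not> collinear {0, u, w}"
    using assms collinear_3[of P2 P1 P3] by (simp add: uw insert_commute)
  then have "u \<noteq> 0"
    unfolding collinear_lemma by blast
  then consider "u$1 \<noteq> 0" | "u$2 \<noteq> 0"
    by (auto simp: vec_eq_iff forall_2)
  then have "\<exists>c. w = c *\<^sub>R u"
  proof cases
    case 1
    then have "w = (w$1 / u$1) *\<^sub>R u"
      using d unfolding vec_eq_iff forall_2 by (simp add: field_simps)
    then show ?thesis ..
  next
    case 2
    then have "w = (w$2 / u$2) *\<^sub>R u"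
      using d unfolding vec_eq_iff forall_2 by (simp add: field_simps)
    then show ?thesis ..
  qed
  with nc show False
    unfolding collinear_lemma by blast
qed

text \<open>The centroid is an interior point, and a convex set is negligible only if its interior
  is empty.\<close>

lemma triangle_not_negligible:
  fixes P1 P2 P3 :: "real^2"
  assumes "\<not> collinear {P1, P2, P3}"
  shows "\<not> negligible (convex hull {P1, P2, P3})"
proof -
  have "(1/3) *\<^sub>R P1 + (1/3) *\<^sub>R P2 + (1/3) *\<^sub>R P3 \<in> interior (convex hull {P1, P2, P3})"
    unfolding interior_convex_hull_3_minimal[OF assms, simplified]
    by (intro CollectI exI[of _ "1/3"] conjI) simp_all
  then show ?thesis
    by (auto simp: negligible_convex_interior)
qed

theorem mainTheorem1:
  fixes P1 P2 P3 m :: "real^2" and \<Delta> :: "(real^2) set"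
  assumes "\<not> collinear {P1, P2, P3}"
    and "\<Delta> = convex hull {P1, P2, P3}"
  shows "m = geometric_median \<Delta> \<longleftrightarrow>
      (segment_dist P1 P2 m / norm (P2 - P1)) *\<^sub>R (P2 - P1)
    + (segment_dist P2 P3 m / norm (P3 - P2)) *\<^sub>R (P3 - P2)
    + (segment_dist P3 P1 m / norm (P1 - P3)) *\<^sub>R (P1 - P3) = 0"
proof -
  define u w where uw: "u = P2 - P1" "w = P3 - P1"
  define d where "d = u$1 * w$2 - u$2 * w$1"
  define I where "I v = (LINT P:\<Delta>|lborel. sgn (P - m) \<bullet> v)" for v
  define A12 A23 A31 where A: "A12 = segment_dist P1 P2 m / norm (P2 - P1)"
    "A23 = segment_dist P2 P3 m / norm (P3 - P2)" "A31 = segment_dist P3 P1 m / norm (P1 - P3)"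
  have "d \<noteq> 0"
    using not_collinear_imp_det_nonzero[OF assms(1)] by (simp add: d_def uw)
  have compact: "compact \<Delta>"
    by (simp add: assms(2) compact_convex_hull finite_imp_compact)
  have "\<not> negligible \<Delta>"
    using triangle_not_negligible[OF assms(1)] by (simp add: assms(2))
  have Iu: "I u = \<bar>d\<bar> * (A23 - A31)"
    using sgn_integral_triangle[of u w P1 m] \<open>d \<noteq> 0\<close> segment_dist_commute[of P1 P3 m]
    by (simp add: I_def d_def A assms(2) uw norm_minus_commute)
  \<comment> \<open>Exchanging \<open>u\<close> and \<open>w\<close> only flips the sign of the
    determinant, so the chord formula also serves for chords parallel to \<open>w\<close>.\<close>
  have "\<bar>w$1 * u$2 - w$2 * u$1\<bar> = \<bar>d\<bar>"
    unfolding d_def by (simp add: abs_minus_commute mult.commute)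
  then have Iw: "I w = \<bar>d\<bar> * (A23 - A12)"
    using sgn_integral_triangle[of w u P1 m] \<open>d \<noteq> 0\<close> segment_dist_commute[of P2 P3 m]
    by (simp add: I_def A assms(2) uw norm_minus_commute insert_commute)
  have I_linear: "I (\<alpha> *\<^sub>R u + \<beta> *\<^sub>R w) = \<alpha> * I u + \<beta> * I w" for \<alpha> \<beta>
    unfolding I_def
    by (simp add: inner_add_right set_integral_add set_integrable_sgn_inner[OF compact])
  \<comment> \<open>Cramer's rule for the coordinates of \<open>v\<close> in the basis
    \<open>u\<close>, \<open>w\<close>; by linearity \<open>I\<close> then vanishes everywhere once
    it vanishes at \<open>u\<close> and \<open>w\<close>.\<close>
  have span: "v = ((v$1 * w$2 - v$2 * w$1) / d) *\<^sub>R u + ((u$1 * v$2 - u$2 * v$1) / d) *\<^sub>R w" for v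
  proof -
    have "v$1 * d = (v$1 * w$2 - v$2 * w$1) * u$1 + (u$1 * v$2 - u$2 * v$1) * w$1"
      "v$2 * d = (v$1 * w$2 - v$2 * w$1) * u$2 + (u$1 * v$2 - u$2 * v$1) * w$2"
      unfolding d_def by algebra+
    then show ?thesis
      using \<open>d \<noteq> 0\<close> by (simp add: vec_eq_iff forall_2 add_divide_distrib[symmetric] eq_divide_eq)
  qed
  have "m = geometric_median \<Delta> \<longleftrightarrow> (\<forall>v. I v = 0)"
    unfolding I_def using geometric_median_iff_minimal region_dist_minimal_iff compact \<open>\<not> negligible \<Delta>\<close>
    by simp
  also have "\<dots> \<longleftrightarrow> I u = 0 \<and> I w = 0"
    using I_linear span by (metis add.right_neutral mult_zero_right)
  also have "\<dots> \<longleftrightarrow> A23 = A31 \<and> A23 = A12"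
    using \<open>d \<noteq> 0\<close> by (simp add: Iu Iw)
  also have "\<dots> \<longleftrightarrow> (A12 - A23) *\<^sub>R u + (A23 - A31) *\<^sub>R w = 0"
  proof
    assume "(A12 - A23) *\<^sub>R u + (A23 - A31) *\<^sub>R w = 0"
    then have "(A12 - A23) * u$1 + (A23 - A31) * w$1 = 0" "(A12 - A23) * u$2 + (A23 - A31) * w$2 = 0"
      by (auto simp: vec_eq_iff forall_2)
    then have "(A12 - A23) * d = 0" "(A23 - A31) * d = 0"
      unfolding d_def by algebra+
    then show "A23 = A31 \<and> A23 = A12"
      using \<open>d \<noteq> 0\<close> by simp
  qed simp
  \<comment> \<open>The edges are \<open>u\<close>, \<open>w - u\<close> and \<open>- w\<close>;
    collecting coefficients gives the vector equation.\<close>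
  also have "(A12 - A23) *\<^sub>R u + (A23 - A31) *\<^sub>R w =
      A12 *\<^sub>R (P2 - P1) + A23 *\<^sub>R (P3 - P2) + A31 *\<^sub>R (P1 - P3)"
    unfolding uw by (simp add: algebra_simps)
  finally show ?thesis
    unfolding A .
qed

end
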